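(* A semiring $S$ is m-semisimple if and only if it is a subdirect product of m-primitive semirings. Likewise, a semiring $S$ is s-semisimple if and only if it is a subdirect product of s-primitive semirings.
   Context: A semiring $(S,+,\cdot)$ is a set with $(S,+)$ a commutative monoid with identity $0$, $(S,\cdot)$ a semigroup (no multiplicative identity is assumed), multiplication distributing over addition on both sides, and $0s=s0=0$ for all $s$. Homomorphisms preserve $+,\cdot,0$. $\Delta_S=\{(s,s)\mid s\in S\}$, $\nabla_S=S\times S$. An $S$-semimodule is a right $S$-semimodule: a commutative monoid $(M,+,0_M)$ with a map $M\times S\to M$ such that $(m_1+m_2)s=m_1s+m_2s$, $m(s_1+s_2)=ms_1+ms_2$, $m(s_1s_2)=(ms_1)s_2$, $m0=0_M=0_Ms$. $M$ is called minimal if $MS\neq 0$ (i.e. $ms\ne 0_M$ for some $m\in M,s\in S$) and its only subsemimodules are $(0)$ and $M$; it is called simple if it is minimal and its only $S$-semimodule congruences are the equality relation and $M\times M$. $\mathrm{ann}_S(M)=\{(s_1,s_2)\in S\times S\mid ms_1=ms_2 \text{ for all } m\in M\}$; $M$ is faithful if $\mathrm{ann}_S(M)=\Delta_S$. $\mathrm{rad}_m(S)$ (resp. $\mathrm{rad}_s(S)$) is the intersection of $\mathrm{ann}_S(M)$ over all minimal (resp. simple) $S$-semimodules $M$, and is $\nabla_S$ if there are none. $S$ is m-semisimple if $\mathrm{rad}_m(S)=\Delta_S$, and s-semisimple if $\mathrm{rad}_s(S)=\Delta_S$. $S$ is m-primitive (resp. s-primitive) if there is a faithful minimal (resp. faithful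 simple) $S$-semimodule. $S$ is a subdirect product of a family $\{S_\alpha\}_{\alpha\in\Lambda}$ of semirings (the index set may be empty, the empty product being the zero semiring) if there is an injective semiring homomorphism $\phi:S\to\prod_{\alpha\in\Lambda}S_\alpha$ such that $\pi_\alpha\circ\phi:S\to S_\alpha$ is surjective for each $\alpha\in\Lambda$, where $\pi_\alpha$ is the projection. *)

theory Defs
  imports "HOL-Algebra.Ring"
begin

section \<open>Semirings without multiplicative identity\<close>

text \<open>
  The locale \<open>semiring\<close> of HOL-Algebra assumes a multiplicative identity. We keep
  the record type \<open>ring\<close>, but nothing below refers to its field \<open>one\<close>, which may hold
  an arbitrary value.
\<close>

locale hemiring = abelian_monoid S for S (structure) +
  assumes m_closed: "\<lbrakk>x \<in> carrier S; y \<in> carrier S\<rbrakk> \<Longrightarrow> x \<otimes> y \<in> carrier S"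
    and m_assoc: "\<lbrakk>x \<in> carrier S; y \<in> carrier S; z \<in> carrier S\<rbrakk>
      \<Longrightarrow> (x \<otimes> y) \<otimes> z = x \<otimes> (y \<otimes> z)"
    and l_distr: "\<lbrakk>x \<in> carrier S; y \<in> carrier S; z \<in> carrier S\<rbrakk>
      \<Longrightarrow> (x \<oplus> y) \<otimes> z = x \<otimes> z \<oplus> y \<otimes> z"
    and r_distr: "\<lbrakk>x \<in> carrier S; y \<in> carrier S; z \<in> carrier S\<rbrakk>
      \<Longrightarrow> z \<otimes> (x \<oplus> y) = z \<otimes> x \<oplus> z \<otimes> y"
    and l_null: "x \<in> carrier S \<Longrightarrow> \<zero> \<otimes> x = \<zero>"
    and r_null: "x \<in> carrier S \<Longrightarrow> x \<otimes> \<zero> = \<zero>"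

definition hemiring_hom :: "('a, 'x) ring_scheme \<Rightarrow> ('b, 'y) ring_scheme \<Rightarrow> ('a \<Rightarrow> 'b) set" where
  "hemiring_hom S T = {f. f \<in> carrier S \<rightarrow> carrier T
     \<and> (\<forall>x\<in>carrier S. \<forall>y\<in>carrier S. f (x \<oplus>\<^bsub>S\<^esub> y) = f x \<oplus>\<^bsub>T\<^esub> f y)
     \<and> (\<forall>x\<in>carrier S. \<forall>y\<in>carrier S. f (x \<otimes>\<^bsub>S\<^esub> y) = f x \<otimes>\<^bsub>T\<^esub> f y)
     \<and> f \<zero>\<^bsub>S\<^esub> = \<zero>\<^bsub>T\<^esub>}"

definition prod_hemiring :: "'i set \<Rightarrow> ('i \<Rightarrow> ('b, 'y) ring_scheme) \<Rightarrow> ('i \<Rightarrow> 'b) ring" where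
  "prod_hemiring \<Lambda> F =
    \<lparr> carrier = (\<Pi>\<^sub>E \<alpha>\<in>\<Lambda>. carrier (F \<alpha>)),
      mult = (\<lambda>f g. \<lambda>\<alpha>\<in>\<Lambda>. f \<alpha> \<otimes>\<^bsub>F \<alpha>\<^esub> g \<alpha>),
      one = undefined,
      zero = (\<lambda>\<alpha>\<in>\<Lambda>. \<zero>\<^bsub>F \<alpha>\<^esub>),
      add = (\<lambda>f g. \<lambda>\<alpha>\<in>\<Lambda>. f \<alpha> \<oplus>\<^bsub>F \<alpha>\<^esub> g \<alpha>) \<rparr>"

text \<open>For \<open>\<Lambda> = {}\<close> the product has the single element \<open>\<lambda>_. undefined\<close>: the zero semiring.\<close>

definition subdirect_product ::
  "('a, 'x) ring_scheme \<Rightarrow> 'i set \<Rightarrow> ('i \<Rightarrow> ('b, 'y) ring_scheme) \<Rightarrow> bool" where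
  "subdirect_product S \<Lambda> F \<longleftrightarrow>
     (\<forall>\<alpha>\<in>\<Lambda>. hemiring (F \<alpha>)) \<and>
     (\<exists>\<phi> \<in> hemiring_hom S (prod_hemiring \<Lambda> F).
        inj_on \<phi> (carrier S) \<and>
        (\<forall>\<alpha>\<in>\<Lambda>. (\<lambda>x. \<phi> x \<alpha>) ` carrier S = carrier (F \<alpha>)))"


section \<open>Right semimodules\<close>

text \<open>The fields \<open>mult\<close> and \<open>one\<close> inherited from the record \<open>ring\<close> are not used.\<close>

record ('s, 'm) semimodule = "'m ring" +
  act :: "'m \<Rightarrow> 's \<Rightarrow> 'm" (infixl \<open>\<bullet>\<index>\<close> 70)

locale right_semimodule = S: hemiring S + M: abelian_monoid M
  for S (structure) and M (structure) +
  assumes act_closed: "\<lbrakk>m \<in> carrier M; s \<in> carrier S\<rbrakk> \<Longrightarrow> m \<bullet>\<^bsub>M\<^esub> s \<in> carrier M"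
    and act_add_left: "\<lbrakk>m \<in> carrier M; n \<in> carrier M; s \<in> carrier S\<rbrakk>
      \<Longrightarrow> (m \<oplus>\<^bsub>M\<^esub> n) \<bullet>\<^bsub>M\<^esub> s = m \<bullet>\<^bsub>M\<^esub> s \<oplus>\<^bsub>M\<^esub> n \<bullet>\<^bsub>M\<^esub> s"
    and act_add_right: "\<lbrakk>m \<in> carrier M; s \<in> carrier S; t \<in> carrier S\<rbrakk>
      \<Longrightarrow> m \<bullet>\<^bsub>M\<^esub> (s \<oplus>\<^bsub>S\<^esub> t) = m \<bullet>\<^bsub>M\<^esub> s \<oplus>\<^bsub>M\<^esub> m \<bullet>\<^bsub>M\<^esub> t"
    and act_mult: "\<lbrakk>m \<in> carrier M; s \<in> carrier S; t \<in> carrier S\<rbrakk>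
      \<Longrightarrow> m \<bullet>\<^bsub>M\<^esub> (s \<otimes>\<^bsub>S\<^esub> t) = (m \<bullet>\<^bsub>M\<^esub> s) \<bullet>\<^bsub>M\<^esub> t"
    and act_zero: "m \<in> carrier M \<Longrightarrow> m \<bullet>\<^bsub>M\<^esub> \<zero>\<^bsub>S\<^esub> = \<zero>\<^bsub>M\<^esub>"
    and zero_act: "s \<in> carrier S \<Longrightarrow> \<zero>\<^bsub>M\<^esub> \<bullet>\<^bsub>M\<^esub> s = \<zero>\<^bsub>M\<^esub>"

definition subsemimodule ::
  "'m set \<Rightarrow> ('a, 'x) ring_scheme \<Rightarrow> ('a, 'm, 'z) semimodule_scheme \<Rightarrow> bool" where
  "subsemimodule N S M \<longleftrightarrow> N \<subseteq> carrier M \<and> \<zero>\<^bsub>M\<^esub> \<in> N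
     \<and> (\<forall>x\<in>N. \<forall>y\<in>N. x \<oplus>\<^bsub>M\<^esub> y \<in> N)
     \<and> (\<forall>x\<in>N. \<forall>s\<in>carrier S. x \<bullet>\<^bsub>M\<^esub> s \<in> N)"

definition semimodule_congruence ::
  "('m \<times> 'm) set \<Rightarrow> ('a, 'x) ring_scheme \<Rightarrow> ('a, 'm, 'z) semimodule_scheme \<Rightarrow> bool" where
  "semimodule_congruence r S M \<longleftrightarrow> equiv (carrier M) r
     \<and> (\<forall>(x, y)\<in>r. \<forall>(x', y')\<in>r. (x \<oplus>\<^bsub>M\<^esub> x', y \<oplus>\<^bsub>M\<^esub> y') \<in> r)
     \<and> (\<forall>(x, y)\<in>r. \<forall>s\<in>carrier S. (x \<bullet>\<^bsub>M\<^esub> s, y \<bullet>\<^bsub>M\<^esub> s) \<in> r)"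

definition minimal_semimodule ::
  "('a, 'x) ring_scheme \<Rightarrow> ('a, 'm, 'z) semimodule_scheme \<Rightarrow> bool" where
  "minimal_semimodule S M \<longleftrightarrow> right_semimodule S M
     \<and> (\<exists>m\<in>carrier M. \<exists>s\<in>carrier S. m \<bullet>\<^bsub>M\<^esub> s \<noteq> \<zero>\<^bsub>M\<^esub>)
     \<and> (\<forall>N. subsemimodule N S M \<longrightarrow> N = {\<zero>\<^bsub>M\<^esub>} \<or> N = carrier M)"

definition simple_semimodule ::
  "('a, 'x) ring_scheme \<Rightarrow> ('a, 'm, 'z) semimodule_scheme \<Rightarrow> bool" where
  "simple_semimodule S M \<longleftrightarrow> minimal_semimodule S M
     \<and> (\<forall>r. semimodule_congruence r S M \<longrightarrow> r = Id_on (carrier M) \<or> r = carrier M \<times> carrier M)"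

definition ann :: "('a, 'x) ring_scheme \<Rightarrow> ('a, 'm, 'z) semimodule_scheme \<Rightarrow> ('a \<times> 'a) set" where
  "ann S M = {(s, t) \<in> carrier S \<times> carrier S. \<forall>m\<in>carrier M. m \<bullet>\<^bsub>M\<^esub> s = m \<bullet>\<^bsub>M\<^esub> t}"

definition faithful_semimodule ::
  "('a, 'x) ring_scheme \<Rightarrow> ('a, 'm, 'z) semimodule_scheme \<Rightarrow> bool" where
  "faithful_semimodule S M \<longleftrightarrow> ann S M = Id_on (carrier S)"


section \<open>Radicals, semisimplicity and primitivity\<close>

text \<open>
  HOL cannot quantify over types, so the semimodules below have their elements in the
  element type \<open>'a\<close> of \<open>S\<close>. This loses nothing: in a minimal semimodule \<open>M\<close> some cyclic
  subsemimodule \<open>mS\<close> is nonzero, hence equals \<open>M\<close>, and so \<open>M\<close> is a quotient of \<open>S\<close> and has an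
  isomorphic copy inside \<open>'a\<close>. The lemmas \<open>rad_m_subset_ann\<close>, \<open>rad_s_subset_ann\<close>,
  \<open>m_primitiveI\<close> and \<open>s_primitiveI\<close> below establish this for semimodules over every type.
\<close>

definition rad_m :: "('a, 'x) ring_scheme \<Rightarrow> ('a \<times> 'a) set" where
  "rad_m S = {p \<in> carrier S \<times> carrier S.
     \<forall>M :: ('a, 'a) semimodule. minimal_semimodule S M \<longrightarrow> p \<in> ann S M}"

definition rad_s :: "('a, 'x) ring_scheme \<Rightarrow> ('a \<times> 'a) set" where
  "rad_s S = {p \<in> carrier S \<times> carrier S.
     \<forall>M :: ('a, 'a) semimodule. simple_semimodule S M \<longrightarrow> p \<in> ann S M}"

definition m_semisimple :: "('a, 'x) ring_scheme \<Rightarrow> bool" where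
  "m_semisimple S \<longleftrightarrow> rad_m S = Id_on (carrier S)"

definition s_semisimple :: "('a, 'x) ring_scheme \<Rightarrow> bool" where
  "s_semisimple S \<longleftrightarrow> rad_s S = Id_on (carrier S)"

definition m_primitive :: "('a, 'x) ring_scheme \<Rightarrow> bool" where
  "m_primitive S \<longleftrightarrow>
     (\<exists>M :: ('a, 'a) semimodule. minimal_semimodule S M \<and> faithful_semimodule S M)"

definition s_primitive :: "('a, 'x) ring_scheme \<Rightarrow> bool" where
  "s_primitive S \<longleftrightarrow>
     (\<exists>M :: ('a, 'a) semimodule. simple_semimodule S M \<and> faithful_semimodule S M)"


section \<open>Independence of the element type of the semimodules\<close>

context
  fixes S :: "('a, 'x) ring_scheme" and M :: "('a, 'm, 'z) semimodule_scheme"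
    and r :: "'m \<Rightarrow> 'a" and h :: "'a \<Rightarrow> 'm" and N :: "('a, 'a) semimodule"
  assumes M: "right_semimodule S M" and hr: "\<And>x. x \<in> carrier M \<Longrightarrow> h (r x) = x"
  defines "N \<equiv> \<lparr> carrier = r ` carrier M, mult = undefined, one = undefined,
    zero = r \<zero>\<^bsub>M\<^esub>, add = (\<lambda>s t. r (h s \<oplus>\<^bsub>M\<^esub> h t)), act = (\<lambda>s t. r (h s \<bullet>\<^bsub>M\<^esub> t)) \<rparr>"
begin

interpretation right_semimodule S M by (rule M)

private lemma N_simps:
  "carrier N = r ` carrier M" "zero N = r \<zero>\<^bsub>M\<^esub>"
  "add N s t = r (h s \<oplus>\<^bsub>M\<^esub> h t)" "act N s t = r (h s \<bullet>\<^bsub>M\<^esub> t)"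
  by (simp_all add: N_def)

private lemma r_eq: "\<lbrakk>x \<in> carrier M; y \<in> carrier M\<rbrakk> \<Longrightarrow> r x = r y \<longleftrightarrow> x = y"
  using hr by metis

private lemma transport_right_semimodule: "right_semimodule S N"
proof -
  have "abelian_monoid N"
    by (rule abelian_monoidI) (auto simp: N_simps hr M.a_ac)
  then show ?thesis
    by (intro right_semimodule.intro right_semimodule_axioms.intro S.hemiring_axioms)
      (auto simp: N_simps hr act_closed act_add_left act_add_right act_mult act_zero zero_act)
qed

private lemma transport_ann: "ann S N = ann S M"
  by (auto simp: ann_def N_simps hr r_eq act_closed)

private lemma transport_subsemimodule:
  assumes "subsemimodule K S N"
  shows "subsemimodule (h ` K) S M" "K = r ` h ` K"
proof -
  have K: "K \<subseteq> r ` carrier M" "r \<zero>\<^bsub>M\<^esub> \<in> K"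
    "\<And>x y. x \<in> K \<Longrightarrow> y \<in> K \<Longrightarrow> r (h x \<oplus>\<^bsub>M\<^esub> h y) \<in> K"
    "\<And>x s. x \<in> K \<Longrightarrow> s \<in> carrier S \<Longrightarrow> r (h x \<bullet>\<^bsub>M\<^esub> s) \<in> K"
    using assms by (auto simp: subsemimodule_def N_simps)
  have hK: "h x \<in> carrier M" "r (h x) = x" if "x \<in> K" for x
    using that K(1) hr by auto
  show "K = r ` h ` K" using hK(2) by (force simp: image_iff)
  show "subsemimodule (h ` K) S M"
    unfolding subsemimodule_def
  proof (intro conjI ballI)
    show "h ` K \<subseteq> carrier M" using hK by auto
    show "\<zero>\<^bsub>M\<^esub> \<in> h ` K" using K(2) hr[of "\<zero>\<^bsub>M\<^esub>"] by (metis M.zero_closed imageI)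
    show "x \<oplus>\<^bsub>M\<^esub> y \<in> h ` K" if "x \<in> h ` K" "y \<in> h ` K" for x y
      using that K(3) hK(1) hr by (metis (no_types, lifting) M.a_closed imageE imageI)
    show "x \<bullet>\<^bsub>M\<^esub> s \<in> h ` K" if "x \<in> h ` K" "s \<in> carrier S" for x s
      using that K(4) hK(1) hr by (metis (no_types, lifting) act_closed imageE imageI)
  qed
qed

private lemma transport_congruence:
  assumes "semimodule_congruence q S N"
  shows "semimodule_congruence (map_prod h h ` q) S M" "q = map_prod r r ` map_prod h h ` q"
proof -
  define p where "p = {(x, y) \<in> carrier M \<times> carrier M. (r x, r y) \<in> q}"
  have eq: "equiv (r ` carrier M) q"
    and q1: "\<And>x y x' y'. (x, y) \<in> q \<Longrightarrow> (x', y') \<in> q \<Longrightarrow>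
      (r (h x \<oplus>\<^bsub>M\<^esub> h x'), r (h y \<oplus>\<^bsub>M\<^esub> h y')) \<in> q"
    and q2: "\<And>x y s. (x, y) \<in> q \<Longrightarrow> s \<in> carrier S \<Longrightarrow> (r (h x \<bullet>\<^bsub>M\<^esub> s), r (h y \<bullet>\<^bsub>M\<^esub> s)) \<in> q"
    using assms unfolding semimodule_congruence_def N_simps by blast+
  have sub: "q \<subseteq> r ` carrier M \<times> r ` carrier M"
    using eq by (simp add: equiv_def)
  have rp: "q = map_prod r r ` p"
    using sub unfolding p_def by fastforce
  have "map_prod h h ` map_prod r r ` p = (\<lambda>z. z) ` p"
    unfolding image_image by (rule image_cong) (auto simp: p_def hr)
  then have hq: "map_prod h h ` q = p"
    using rp by simp
  show "q = map_prod r r ` map_prod h h ` q"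
    unfolding hq by (rule rp)
  have "equiv (carrier M) p"
    using eq unfolding equiv_def p_def refl_on_def sym_def trans_def by blast
  moreover have "(x \<oplus>\<^bsub>M\<^esub> x', y \<oplus>\<^bsub>M\<^esub> y') \<in> p" if "(x, y) \<in> p" "(x', y') \<in> p" for x y x' y'
    using that q1[of "r x" "r y" "r x'" "r y'"] by (simp add: p_def hr)
  moreover have "(x \<bullet>\<^bsub>M\<^esub> s, y \<bullet>\<^bsub>M\<^esub> s) \<in> p" if "(x, y) \<in> p" "s \<in> carrier S" for x y s
    using that q2[of "r x" "r y" s] by (simp add: p_def hr act_closed)
  ultimately show "semimodule_congruence (map_prod h h ` q) S M"
    unfolding hq semimodule_congruence_def by blast
qed

private lemma transport_minimal: "minimal_semimodule S M \<Longrightarrow> minimal_semimodule S N"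
proof -
  assume min: "minimal_semimodule S M"
  have "\<exists>m\<in>carrier N. \<exists>s\<in>carrier S. m \<bullet>\<^bsub>N\<^esub> s \<noteq> \<zero>\<^bsub>N\<^esub>"
    using min by (auto simp: minimal_semimodule_def N_simps hr r_eq act_closed)
  moreover have "K = {\<zero>\<^bsub>N\<^esub>} \<or> K = carrier N" if "subsemimodule K S N" for K
  proof -
    have "h ` K = {\<zero>\<^bsub>M\<^esub>} \<or> h ` K = carrier M"
      using min transport_subsemimodule(1)[OF that] by (auto simp: minimal_semimodule_def)
    then have "r ` h ` K = {\<zero>\<^bsub>N\<^esub>} \<or> r ` h ` K = carrier N"
      unfolding N_simps by (metis image_empty image_insert)
    then show ?thesis unfolding transport_subsemimodule(2)[OF that, symmetric] .
  qed
  ultimately show ?thesis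
    using transport_right_semimodule by (simp add: minimal_semimodule_def)
qed

private lemma transport_simple: "simple_semimodule S M \<Longrightarrow> simple_semimodule S N"
proof -
  assume simple: "simple_semimodule S M"
  have "q = Id_on (carrier N) \<or> q = carrier N \<times> carrier N"
    if "semimodule_congruence q S N" for q
  proof -
    have "map_prod h h ` q = Id_on (carrier M) \<or> map_prod h h ` q = carrier M \<times> carrier M"
      using simple transport_congruence(1)[OF that] by (auto simp: simple_semimodule_def)
    moreover have "map_prod r r ` Id_on (carrier M) = Id_on (carrier N)"
      "map_prod r r ` (carrier M \<times> carrier M) = carrier N \<times> carrier N"
      by (auto simp: N_simps Id_on_def image_iff)
    ultimately have "map_prod r r ` map_prod h h ` q = Id_on (carrier N)
      \<or> map_prod r r ` map_prod h h ` q = carrier N \<times> carrier N"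
      by metis
    then show ?thesis unfolding transport_congruence(2)[OF that, symmetric] .
  qed
  with simple show ?thesis
    using transport_minimal by (simp add: simple_semimodule_def)
qed

lemma transport_semimodule:
  assumes "minimal_semimodule S M"
  shows "\<exists>K :: ('a, 'a) semimodule. minimal_semimodule S K \<and> ann S K = ann S M
    \<and> (simple_semimodule S M \<longrightarrow> simple_semimodule S K)"
  by (intro exI[of _ N] conjI impI transport_ann transport_minimal transport_simple assms)

end

lemma minimal_semimodule_cyclic:
  assumes "minimal_semimodule S M"
  obtains m where "m \<in> carrier M" "carrier M = (\<lambda>s. m \<bullet>\<^bsub>M\<^esub> s) ` carrier S"
proof -
  interpret right_semimodule S M using assms by (simp add: minimal_semimodule_def)
  obtain m s where m: "m \<in> carrier M" and s: "s \<in> carrier S" "m \<bullet>\<^bsub>M\<^esub> s \<noteq> \<zero>\<^bsub>M\<^esub>"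
    using assms by (auto simp: minimal_semimodule_def)
  let ?K = "(\<lambda>s. m \<bullet>\<^bsub>M\<^esub> s) ` carrier S"
  have "subsemimodule ?K S M"
    unfolding subsemimodule_def
  proof (intro conjI ballI)
    show "?K \<subseteq> carrier M" using m act_closed by auto
    show "\<zero>\<^bsub>M\<^esub> \<in> ?K" using act_zero[OF m] by (metis S.zero_closed imageI)
    show "x \<oplus>\<^bsub>M\<^esub> y \<in> ?K" if "x \<in> ?K" "y \<in> ?K" for x y
      using that by (auto simp: act_add_right[OF m, symmetric])
    show "x \<bullet>\<^bsub>M\<^esub> t \<in> ?K" if "x \<in> ?K" "t \<in> carrier S" for x t
      using that by (auto simp: act_mult[OF m, symmetric] S.m_closed)
  qed
  with assms s have "?K = carrier M" by (auto simp: minimal_semimodule_def)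
  then show thesis using that[of m] m by metis
qed

lemma minimal_semimodule_copy:
  fixes S :: "('a, 'x) ring_scheme" and M :: "('a, 'm, 'z) semimodule_scheme"
  assumes "minimal_semimodule S M"
  shows "\<exists>N :: ('a, 'a) semimodule. minimal_semimodule S N \<and> ann S N = ann S M
    \<and> (simple_semimodule S M \<longrightarrow> simple_semimodule S N)"
proof -
  obtain m where m: "carrier M = (\<lambda>s. m \<bullet>\<^bsub>M\<^esub> s) ` carrier S"
    using minimal_semimodule_cyclic[OF assms] by metis
  define r where "r = inv_into (carrier S) (\<lambda>s. m \<bullet>\<^bsub>M\<^esub> s)"
  have "m \<bullet>\<^bsub>M\<^esub> r x = x" if "x \<in> carrier M" for x
    using that m unfolding r_def by (metis f_inv_into_f)
  moreover have "right_semimodule S M" using assms by (simp add: minimal_semimodule_def)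
  ultimately show ?thesis
    by (intro transport_semimodule[where h = "\<lambda>s. m \<bullet>\<^bsub>M\<^esub> s" and r = r] assms)
qed

lemma rad_m_subset_ann:
  assumes "minimal_semimodule S M" shows "rad_m S \<subseteq> ann S M"
  using minimal_semimodule_copy[OF assms] unfolding rad_m_def by blast

lemma rad_s_subset_ann:
  assumes "simple_semimodule S M" shows "rad_s S \<subseteq> ann S M"
proof -
  have "minimal_semimodule S M" using assms by (simp add: simple_semimodule_def)
  from minimal_semimodule_copy[OF this] assms show ?thesis unfolding rad_s_def by blast
qed

lemma m_primitiveI:
  assumes "minimal_semimodule S M" "faithful_semimodule S M" shows "m_primitive S"
  using minimal_semimodule_copy[OF assms(1)] assms(2)
  unfolding m_primitive_def faithful_semimodule_def by auto

lemma s_primitiveI: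
  assumes "simple_semimodule S M" "faithful_semimodule S M" shows "s_primitive S"
proof -
  have "minimal_semimodule S M" using assms(1) by (simp add: simple_semimodule_def)
  from minimal_semimodule_copy[OF this] assms show ?thesis
    unfolding s_primitive_def faithful_semimodule_def by auto
qed

end

theory Submission
  imports Defs
begin

text \<open>
  Everything rests on one observation: along a surjective homomorphism \<open>f : S \<rightarrow> T\<close> a \<open>T\<close>-semimodule
  becomes an \<open>S\<close>-semimodule with \<open>m \<bullet> s = m \<bullet> f s\<close>, and since \<open>f\<close> hits every scalar, exactly the
  same subsets are subsemimodules and exactly the same relations are congruences. Minimality and
  simplicity are therefore the same over \<open>S\<close> and over \<open>T\<close> (\<open>minimal_semimodule_iff\<close>,
  \<open>simple_semimodule_iff\<close>), while annihilators over \<open>S\<close> are the preimages of those over \<open>T\<close>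
  (\<open>ann_iff\<close>).

  If \<open>S\<close> is a subdirect product of primitive semirings, each projection \<open>S \<rightarrow> F \<alpha>\<close> is surjective, so
  a faithful minimal (simple) semimodule over \<open>F \<alpha>\<close> becomes a minimal (simple) \<open>S\<close>-semimodule whose
  annihilator is the kernel of that projection. The radical lies in all these kernels, and they meet
  in the diagonal because \<open>S\<close> embeds in the product (\<open>subdirect_productE\<close>).

  Conversely, a minimal (simple) \<open>S\<close>-semimodule \<open>M\<close> is a faithful semimodule over the quotient
  \<open>S / ann S M\<close> and, by the observation applied to the projection, is still minimal (simple), so this
  quotient is primitive. When the radical is the diagonal, any two distinct elements of \<open>S\<close> are
  separated by some \<open>ann S M\<close>; picking one \<open>M\<close> for every such pair embeds \<open>S\<close> in the product of the
  corresponding quotients (\<open>subdirect_product_of_quotients\<close>). Indexing by pairs, and realising a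
  quotient on chosen representatives of its classes, keeps index set and factors within the types
  \<open>'a \<times> 'a\<close> and \<open>'a\<close>.
\<close>

section \<open>Change of scalars along a surjective homomorphism\<close>

lemma abelian_monoid_cong:
  assumes "abelian_monoid N"
    and "carrier M = carrier N" "\<zero>\<^bsub>M\<^esub> = \<zero>\<^bsub>N\<^esub>" "add M = add N"
  shows "abelian_monoid M"
proof -
  interpret abelian_monoid N by (rule assms(1))
  show ?thesis
    by (rule abelian_monoidI) (auto simp: assms(2-4) a_assoc intro: a_comm)
qed

text \<open>
  The two semimodules are related by hypotheses rather than one being defined from the other, so
  that results can be transferred in both directions: the \<open>S\<close>-semimodule is constructed from the
  \<open>T\<close>-semimodule in one half of the theorem and is given in the other.
\<close>

locale change_of_scalars = S: hemiring S + T: hemiring T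
  for S :: "('a, 'x) ring_scheme" and T :: "('b, 'y) ring_scheme" +
  fixes f :: "'a \<Rightarrow> 'b"
    and M :: "('a, 'm, 'z) semimodule_scheme" and N :: "('b, 'm, 'w) semimodule_scheme"
  assumes hom: "f \<in> hemiring_hom S T" and surj: "f ` carrier S = carrier T"
    and carrier_eq: "carrier M = carrier N" and zero_eq: "\<zero>\<^bsub>M\<^esub> = \<zero>\<^bsub>N\<^esub>"
    and add_eq: "add M = add N"
    and act_eq: "\<lbrakk>m \<in> carrier N; s \<in> carrier S\<rbrakk> \<Longrightarrow> m \<bullet>\<^bsub>M\<^esub> s = m \<bullet>\<^bsub>N\<^esub> f s"
begin

lemma f_simps:
  "s \<in> carrier S \<Longrightarrow> f s \<in> carrier T"
  "\<lbrakk>s \<in> carrier S; t \<in> carrier S\<rbrakk> \<Longrightarrow> f (s \<oplus>\<^bsub>S\<^esub> t) = f s \<oplus>\<^bsub>T\<^esub> f t"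
  "\<lbrakk>s \<in> carrier S; t \<in> carrier S\<rbrakk> \<Longrightarrow> f (s \<otimes>\<^bsub>S\<^esub> t) = f s \<otimes>\<^bsub>T\<^esub> f t"
  "f \<zero>\<^bsub>S\<^esub> = \<zero>\<^bsub>T\<^esub>"
  using hom by (auto simp: hemiring_hom_def)

lemma ball_scalars: "(\<forall>t\<in>carrier T. P t) \<longleftrightarrow> (\<forall>s\<in>carrier S. P (f s))"
  unfolding surj[symmetric] by blast

lemma bex_scalars: "(\<exists>t\<in>carrier T. P t) \<longleftrightarrow> (\<exists>s\<in>carrier S. P (f s))"
  unfolding surj[symmetric] by blast

lemma right_semimodule_restrict:
  assumes "right_semimodule T N"
  shows "right_semimodule S M"
proof -
  interpret N: right_semimodule T N by (rule assms)
  have "abelian_monoid M"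
    using N.M.abelian_monoid_axioms carrier_eq zero_eq add_eq by (rule abelian_monoid_cong)
  then show ?thesis
    by (intro right_semimodule.intro right_semimodule_axioms.intro S.hemiring_axioms)
      (simp_all add: carrier_eq zero_eq add_eq act_eq f_simps S.m_closed N.act_closed
        N.act_add_left N.act_add_right N.act_mult N.act_zero N.zero_act)
qed

lemma right_semimodule_extend:
  assumes "right_semimodule S M"
  shows "right_semimodule T N"
proof -
  interpret M: right_semimodule S M by (rule assms)
  have closed: "m \<bullet>\<^bsub>N\<^esub> f s \<in> carrier N" if "m \<in> carrier N" "s \<in> carrier S" for m s
    using M.act_closed[of m s] that by (simp add: carrier_eq act_eq)
  have "abelian_monoid N"
    using M.M.abelian_monoid_axioms carrier_eq[symmetric] zero_eq[symmetric] add_eq[symmetric]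
    by (rule abelian_monoid_cong)
  moreover have "right_semimodule_axioms T N"
  proof
    fix m t assume m: "m \<in> carrier N" and "t \<in> carrier T"
    then obtain s where s: "s \<in> carrier S" "t = f s" using surj by auto
    show "m \<bullet>\<^bsub>N\<^esub> t \<in> carrier N" using closed m s by simp
  next
    fix m n t assume m: "m \<in> carrier N" "n \<in> carrier N" and "t \<in> carrier T"
    then obtain s where s: "s \<in> carrier S" "t = f s" using surj by auto
    show "(m \<oplus>\<^bsub>N\<^esub> n) \<bullet>\<^bsub>N\<^esub> t = m \<bullet>\<^bsub>N\<^esub> t \<oplus>\<^bsub>N\<^esub> n \<bullet>\<^bsub>N\<^esub> t"
      using M.act_add_left[of m n s] M.M.a_closed[of m n] m s
      by (simp add: carrier_eq add_eq act_eq)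
  next
    fix m t u assume m: "m \<in> carrier N" and "t \<in> carrier T" "u \<in> carrier T"
    then obtain s r where s: "s \<in> carrier S" "t = f s" "r \<in> carrier S" "u = f r"
      unfolding surj[symmetric] by auto
    show "m \<bullet>\<^bsub>N\<^esub> (t \<oplus>\<^bsub>T\<^esub> u) = m \<bullet>\<^bsub>N\<^esub> t \<oplus>\<^bsub>N\<^esub> m \<bullet>\<^bsub>N\<^esub> u"
      using M.act_add_right[of m s r] m s by (simp add: carrier_eq add_eq act_eq f_simps)
    show "m \<bullet>\<^bsub>N\<^esub> (t \<otimes>\<^bsub>T\<^esub> u) = (m \<bullet>\<^bsub>N\<^esub> t) \<bullet>\<^bsub>N\<^esub> u"
      using M.act_mult[of m s r] m s by (simp add: carrier_eq act_eq f_simps S.m_closed closed)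
  next
    fix m assume m: "m \<in> carrier N"
    show "m \<bullet>\<^bsub>N\<^esub> \<zero>\<^bsub>T\<^esub> = \<zero>\<^bsub>N\<^esub>"
      using M.act_zero[of m] m act_eq[of m "\<zero>\<^bsub>S\<^esub>"] by (simp add: carrier_eq zero_eq f_simps)
  next
    fix t assume "t \<in> carrier T"
    then obtain s where s: "s \<in> carrier S" "t = f s" using surj by auto
    have "\<zero>\<^bsub>N\<^esub> \<in> carrier N" using M.M.zero_closed by (simp add: carrier_eq zero_eq)
    then show "\<zero>\<^bsub>N\<^esub> \<bullet>\<^bsub>N\<^esub> t = \<zero>\<^bsub>N\<^esub>"
      using M.zero_act[of s] s by (simp add: zero_eq act_eq)
  qed
  ultimately show ?thesis
    by (intro right_semimodule.intro T.hemiring_axioms)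
qed

lemma right_semimodule_iff: "right_semimodule S M \<longleftrightarrow> right_semimodule T N"
  using right_semimodule_restrict right_semimodule_extend by blast

lemma subsemimodule_iff: "subsemimodule K S M \<longleftrightarrow> subsemimodule K T N"
proof (cases "K \<subseteq> carrier N")
  case True
  then have "x \<bullet>\<^bsub>M\<^esub> s = x \<bullet>\<^bsub>N\<^esub> f s" if "x \<in> K" "s \<in> carrier S" for x s
    using that act_eq by blast
  then show ?thesis
    by (simp add: subsemimodule_def ball_scalars carrier_eq zero_eq add_eq)
qed (simp add: subsemimodule_def carrier_eq)

lemma semimodule_congruence_iff: "semimodule_congruence r S M \<longleftrightarrow> semimodule_congruence r T N"
proof (cases "equiv (carrier N) r")
  case True
  then have "x \<bullet>\<^bsub>M\<^esub> s = x \<bullet>\<^bsub>N\<^esub> f s" "y \<bullet>\<^bsub>M\<^esub> s = y \<bullet>\<^bsub>N\<^esub> f s"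
    if "(x, y) \<in> r" "s \<in> carrier S" for x y s
    using that act_eq equiv_type[OF True] by auto
  then have "(\<forall>(x, y)\<in>r. \<forall>s\<in>carrier S. (x \<bullet>\<^bsub>M\<^esub> s, y \<bullet>\<^bsub>M\<^esub> s) \<in> r)
    \<longleftrightarrow> (\<forall>(x, y)\<in>r. \<forall>t\<in>carrier T. (x \<bullet>\<^bsub>N\<^esub> t, y \<bullet>\<^bsub>N\<^esub> t) \<in> r)"
    unfolding ball_scalars by (intro ball_cong refl) auto
  then show ?thesis
    by (simp add: semimodule_congruence_def carrier_eq add_eq)
qed (simp add: semimodule_congruence_def carrier_eq)

lemma minimal_semimodule_iff: "minimal_semimodule S M \<longleftrightarrow> minimal_semimodule T N"
  unfolding minimal_semimodule_def right_semimodule_iff subsemimodule_iff bex_scalars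
  by (simp add: carrier_eq zero_eq act_eq)

lemma simple_semimodule_iff: "simple_semimodule S M \<longleftrightarrow> simple_semimodule T N"
  unfolding simple_semimodule_def minimal_semimodule_iff semimodule_congruence_iff
  by (simp add: carrier_eq)

lemma ann_iff:
  assumes "s \<in> carrier S" "t \<in> carrier S"
  shows "(s, t) \<in> ann S M \<longleftrightarrow> (f s, f t) \<in> ann T N"
  using assms by (simp add: ann_def carrier_eq act_eq f_simps)

end

text \<open>
  The semimodule is kept over its own type: the independence of the radical from the element type
  takes care of moving it into the element type of \<open>S\<close>.
\<close>

lemma restriction_of_scalars:
  fixes N :: "('b, 'm, 'w) semimodule_scheme" and S :: "('a, 'x) ring_scheme"
  assumes "hemiring S" "hemiring T" "f \<in> hemiring_hom S T" "f ` carrier S = carrier T"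
  obtains M :: "('a, 'm) semimodule" where "change_of_scalars S T f M N"
proof
  let ?M = "\<lparr> carrier = carrier N, mult = undefined, one = undefined, zero = \<zero>\<^bsub>N\<^esub>,
    add = add N, act = (\<lambda>m s. m \<bullet>\<^bsub>N\<^esub> f s) \<rparr>"
  show "change_of_scalars S T f ?M N"
    using assms by (intro change_of_scalars.intro change_of_scalars_axioms.intro) auto
qed

text \<open>
  Restricting a faithful semimodule along \<open>f\<close> gives one whose annihilator is the kernel of \<open>f\<close>.
\<close>

lemma rad_m_subset_kernel:
  fixes S :: "('a, 'x) ring_scheme" and T :: "('b, 'y) ring_scheme"
  assumes "hemiring S" "hemiring T" "f \<in> hemiring_hom S T" "f ` carrier S = carrier T"
    and "m_primitive T" and "(s, t) \<in> rad_m S"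
  shows "f s = f t"
proof -
  obtain N :: "('b, 'b) semimodule"
    where N: "minimal_semimodule T N" "ann T N = Id_on (carrier T)"
    using assms(5) unfolding m_primitive_def faithful_semimodule_def by blast
  obtain M :: "('a, 'b) semimodule" where "change_of_scalars S T f M N"
    using restriction_of_scalars[OF assms(1-4)] .
  then interpret change_of_scalars S T f M N .
  have "(s, t) \<in> ann S M"
    using rad_m_subset_ann[of S M] N(1) assms(6) by (auto simp: minimal_semimodule_iff)
  moreover have "s \<in> carrier S" "t \<in> carrier S"
    using assms(6) by (auto simp: rad_m_def)
  ultimately show ?thesis
    by (auto simp: ann_iff N(2))
qed

lemma rad_s_subset_kernel:
  fixes S :: "('a, 'x) ring_scheme" and T :: "('b, 'y) ring_scheme"
  assumes "hemiring S" "hemiring T" "f \<in> hemiring_hom S T" "f ` carrier S = carrier T"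
    and "s_primitive T" and "(s, t) \<in> rad_s S"
  shows "f s = f t"
proof -
  obtain N :: "('b, 'b) semimodule"
    where N: "simple_semimodule T N" "ann T N = Id_on (carrier T)"
    using assms(5) unfolding s_primitive_def faithful_semimodule_def by blast
  obtain M :: "('a, 'b) semimodule" where "change_of_scalars S T f M N"
    using restriction_of_scalars[OF assms(1-4)] .
  then interpret change_of_scalars S T f M N .
  have "(s, t) \<in> ann S M"
    using rad_s_subset_ann[of S M] N(1) assms(6) by (auto simp: simple_semimodule_iff)
  moreover have "s \<in> carrier S" "t \<in> carrier S"
    using assms(6) by (auto simp: rad_s_def)
  ultimately show ?thesis
    by (auto simp: ann_iff N(2))
qed


section \<open>Quotients by congruences\<close>

definition hemiring_congruence :: "('a \<times> 'a) set \<Rightarrow> ('a, 'x) ring_scheme \<Rightarrow> bool" where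
  "hemiring_congruence q S \<longleftrightarrow> equiv (carrier S) q
     \<and> (\<forall>(x, y)\<in>q. \<forall>(x', y')\<in>q. (x \<oplus>\<^bsub>S\<^esub> x', y \<oplus>\<^bsub>S\<^esub> y') \<in> q)
     \<and> (\<forall>(x, y)\<in>q. \<forall>(x', y')\<in>q. (x \<otimes>\<^bsub>S\<^esub> x', y \<otimes>\<^bsub>S\<^esub> y') \<in> q)"

definition class_rep :: "('a \<times> 'a) set \<Rightarrow> 'a \<Rightarrow> 'a" where
  "class_rep q x = (SOME y. y \<in> q `` {x})"

text \<open>
  The elements are representatives of the classes instead of the classes themselves, so that a
  quotient of \<open>S\<close> has the element type of \<open>S\<close>.
\<close>

definition quotient_hemiring :: "('a, 'x) ring_scheme \<Rightarrow> ('a \<times> 'a) set \<Rightarrow> 'a ring" where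
  "quotient_hemiring S q =
    \<lparr> carrier = class_rep q ` carrier S,
      mult = (\<lambda>x y. class_rep q (x \<otimes>\<^bsub>S\<^esub> y)),
      one = undefined,
      zero = class_rep q \<zero>\<^bsub>S\<^esub>,
      add = (\<lambda>x y. class_rep q (x \<oplus>\<^bsub>S\<^esub> y)) \<rparr>"

lemma class_rep_related:
  assumes "equiv A q" "x \<in> A"
  shows "(x, class_rep q x) \<in> q"
  using someI[of "\<lambda>y. y \<in> q `` {x}" x] equiv_class_self[OF assms]
  by (simp add: class_rep_def)

lemma class_rep_eq_iff:
  assumes "equiv A q" "x \<in> A" "y \<in> A"
  shows "class_rep q x = class_rep q y \<longleftrightarrow> (x, y) \<in> q"
proof
  assume "class_rep q x = class_rep q y"
  then have "(x, class_rep q y) \<in> q" "(y, class_rep q y) \<in> q"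
    using class_rep_related[OF assms(1)] assms(2,3) by metis+
  then show "(x, y) \<in> q"
    using assms(1) by (meson equiv_def symE transE)
next
  assume "(x, y) \<in> q"
  then show "class_rep q x = class_rep q y"
    using equiv_class_eq[OF assms(1)] by (simp add: class_rep_def)
qed

context
  fixes S :: "('a, 'x) ring_scheme" and q :: "('a \<times> 'a) set"
  assumes S: "hemiring S" and q: "hemiring_congruence q S"
begin

interpretation S: hemiring S by (rule S)

private lemma equiv_q: "equiv (carrier S) q"
  using q by (simp add: hemiring_congruence_def)

private lemma rep_closed: "x \<in> carrier S \<Longrightarrow> class_rep q x \<in> carrier S"
  using class_rep_related[OF equiv_q] equiv_type[OF equiv_q] by blast

private lemma rep_eqI: "(x, y) \<in> q \<Longrightarrow> class_rep q x = class_rep q y"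
  using class_rep_eq_iff[OF equiv_q] equiv_type[OF equiv_q] by blast

private lemma rel: "x \<in> carrier S \<Longrightarrow> (class_rep q x, x) \<in> q" "x \<in> carrier S \<Longrightarrow> (x, x) \<in> q"
  using class_rep_related[OF equiv_q] equiv_q unfolding equiv_def by (auto dest: symD refl_onD)

private lemma q_ops:
  assumes "(x, y) \<in> q" "(x', y') \<in> q"
  shows "(x \<oplus>\<^bsub>S\<^esub> x', y \<oplus>\<^bsub>S\<^esub> y') \<in> q" "(x \<otimes>\<^bsub>S\<^esub> x', y \<otimes>\<^bsub>S\<^esub> y') \<in> q"
  using q assms unfolding hemiring_congruence_def by blast+

private lemma rep_simps:
  assumes "x \<in> carrier S" "y \<in> carrier S"
  shows "class_rep q (class_rep q x \<oplus>\<^bsub>S\<^esub> y) = class_rep q (x \<oplus>\<^bsub>S\<^esub> y)"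
    "class_rep q (x \<oplus>\<^bsub>S\<^esub> class_rep q y) = class_rep q (x \<oplus>\<^bsub>S\<^esub> y)"
    "class_rep q (class_rep q x \<otimes>\<^bsub>S\<^esub> y) = class_rep q (x \<otimes>\<^bsub>S\<^esub> y)"
    "class_rep q (x \<otimes>\<^bsub>S\<^esub> class_rep q y) = class_rep q (x \<otimes>\<^bsub>S\<^esub> y)"
  using assms by (auto intro!: rep_eqI q_ops rel)

private lemma rep_idem: "x \<in> carrier S \<Longrightarrow> class_rep q (class_rep q x) = class_rep q x"
  by (intro rep_eqI rel)

private lemma Q_simps:
  "carrier (quotient_hemiring S q) = class_rep q ` carrier S"
  "\<zero>\<^bsub>quotient_hemiring S q\<^esub> = class_rep q \<zero>\<^bsub>S\<^esub>"
  "x \<oplus>\<^bsub>quotient_hemiring S q\<^esub> y = class_rep q (x \<oplus>\<^bsub>S\<^esub> y)"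
  "x \<otimes>\<^bsub>quotient_hemiring S q\<^esub> y = class_rep q (x \<otimes>\<^bsub>S\<^esub> y)"
  by (simp_all add: quotient_hemiring_def)

lemma hemiring_quotient_hemiring: "hemiring (quotient_hemiring S q)"
proof -
  have "abelian_monoid (quotient_hemiring S q)"
    by (rule abelian_monoidI)
      (auto simp: Q_simps rep_simps rep_closed rep_idem S.a_assoc,
        auto simp: S.a_comm rep_closed)
  then show ?thesis
    \<comment> \<open>Inner representatives have to be removed before distributing: expanding
      \<open>class_rep q z \<otimes> (x \<oplus> y)\<close> first would leave them buried inside a sum.\<close>
    by (intro hemiring.intro hemiring_axioms.intro)
      (auto simp: Q_simps rep_simps rep_closed S.m_closed S.m_assoc S.l_null S.r_null,
        auto simp: S.l_distr S.r_distr)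
qed

lemma class_rep_hom: "class_rep q \<in> hemiring_hom S (quotient_hemiring S q)"
  by (auto simp: hemiring_hom_def Q_simps rep_simps rep_closed)

lemma class_rep_surj: "class_rep q ` carrier S = carrier (quotient_hemiring S q)"
  by (simp add: Q_simps)

end

lemma hemiring_congruence_ann:
  assumes "right_semimodule S M"
  shows "hemiring_congruence (ann S M) S"
proof -
  interpret right_semimodule S M by (rule assms)
  have "equiv (carrier S) (ann S M)"
    by (intro equivI refl_onI symI transI) (auto simp: ann_def)
  then show ?thesis
    by (auto simp: hemiring_congruence_def ann_def act_add_right act_mult act_closed S.m_closed)
qed

text \<open>
  Elements with the same class act on \<open>M\<close> in the same way, so the action of a class on \<open>M\<close> is the
  given action of its representative, and \<open>M\<close> need not be changed at all.
\<close>

lemma change_of_scalars_quotient_ann: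
  assumes "right_semimodule S M"
  shows "change_of_scalars S (quotient_hemiring S (ann S M)) (class_rep (ann S M)) M M"
proof -
  interpret right_semimodule S M by (rule assms)
  note cong = hemiring_congruence_ann[OF assms]
  note Q = hemiring_quotient_hemiring[OF S.hemiring_axioms cong]
    class_rep_hom[OF S.hemiring_axioms cong] class_rep_surj[OF S.hemiring_axioms cong]
  have "equiv (carrier S) (ann S M)"
    using cong by (simp add: hemiring_congruence_def)
  then have rep: "(s, class_rep (ann S M) s) \<in> ann S M" if "s \<in> carrier S" for s
    using that by (rule class_rep_related)
  have "m \<bullet>\<^bsub>M\<^esub> s = m \<bullet>\<^bsub>M\<^esub> class_rep (ann S M) s" if "m \<in> carrier M" "s \<in> carrier S" for m s
    using rep[OF that(2)] that(1) unfolding ann_def by blast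
  then show ?thesis
    by (intro change_of_scalars.intro change_of_scalars_axioms.intro S.hemiring_axioms Q refl)
qed

lemma faithful_quotient_ann:
  assumes "right_semimodule S M"
  shows "faithful_semimodule (quotient_hemiring S (ann S M)) M"
proof -
  interpret change_of_scalars S "quotient_hemiring S (ann S M)" "class_rep (ann S M)" M M
    by (rule change_of_scalars_quotient_ann[OF assms])
  have eq: "equiv (carrier S) (ann S M)"
    using hemiring_congruence_ann[OF assms] by (simp add: hemiring_congruence_def)
  let ?Q = "quotient_hemiring S (ann S M)"
  have "(x, y) \<in> ann ?Q M \<longleftrightarrow> x = y" if "x \<in> carrier ?Q" "y \<in> carrier ?Q" for x y
    using that unfolding surj[symmetric]
    by (auto simp: ann_iff[symmetric] class_rep_eq_iff[OF eq])
  moreover have "ann ?Q M \<subseteq> carrier ?Q \<times> carrier ?Q"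
    by (auto simp: ann_def)
  ultimately show ?thesis
    unfolding faithful_semimodule_def by (auto simp: Id_on_def)
qed

lemma m_primitive_quotient_ann:
  assumes "minimal_semimodule S M"
  shows "m_primitive (quotient_hemiring S (ann S M))"
proof -
  have M: "right_semimodule S M"
    using assms by (simp add: minimal_semimodule_def)
  show ?thesis
    using change_of_scalars.minimal_semimodule_iff[OF change_of_scalars_quotient_ann[OF M]] assms
      faithful_quotient_ann[OF M] by (intro m_primitiveI[where M = M]) simp_all
qed

lemma s_primitive_quotient_ann:
  assumes "simple_semimodule S M"
  shows "s_primitive (quotient_hemiring S (ann S M))"
proof -
  have M: "right_semimodule S M"
    using assms by (simp add: simple_semimodule_def minimal_semimodule_def)
  show ?thesis
    using change_of_scalars.simple_semimodule_iff[OF change_of_scalars_quotient_ann[OF M]] assms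
      faithful_quotient_ann[OF M] by (intro s_primitiveI[where M = M]) simp_all
qed


section \<open>Subdirect products\<close>

lemma subdirect_productE:
  assumes "subdirect_product S \<Lambda> F"
  obtains f where
    "\<And>\<alpha>. \<alpha> \<in> \<Lambda> \<Longrightarrow> hemiring (F \<alpha>)"
    "\<And>\<alpha>. \<alpha> \<in> \<Lambda> \<Longrightarrow> f \<alpha> \<in> hemiring_hom S (F \<alpha>)"
    "\<And>\<alpha>. \<alpha> \<in> \<Lambda> \<Longrightarrow> f \<alpha> ` carrier S = carrier (F \<alpha>)"
    "\<And>x y. \<lbrakk>x \<in> carrier S; y \<in> carrier S; \<And>\<alpha>. \<alpha> \<in> \<Lambda> \<Longrightarrow> f \<alpha> x = f \<alpha> y\<rbrakk> \<Longrightarrow> x = y"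
proof -
  obtain \<phi> where hom: "\<phi> \<in> hemiring_hom S (prod_hemiring \<Lambda> F)"
    and inj: "inj_on \<phi> (carrier S)"
    and surj: "\<forall>\<alpha>\<in>\<Lambda>. (\<lambda>x. \<phi> x \<alpha>) ` carrier S = carrier (F \<alpha>)"
    and F: "\<forall>\<alpha>\<in>\<Lambda>. hemiring (F \<alpha>)"
    using assms unfolding subdirect_product_def by (elim conjE bexE)
  show thesis
  proof (rule that[of "\<lambda>\<alpha> x. \<phi> x \<alpha>"])
    show "(\<lambda>x. \<phi> x \<alpha>) \<in> hemiring_hom S (F \<alpha>)" if "\<alpha> \<in> \<Lambda>" for \<alpha>
    proof -
      have "\<phi> x \<alpha> \<in> carrier (F \<alpha>)" if "x \<in> carrier S" for x
        using bspec[OF surj \<open>\<alpha> \<in> \<Lambda>\<close>] that by blast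
      then show ?thesis
        using hom that by (simp add: hemiring_hom_def prod_hemiring_def Pi_iff)
    qed
    show "x = y" if "x \<in> carrier S" "y \<in> carrier S" "\<And>\<alpha>. \<alpha> \<in> \<Lambda> \<Longrightarrow> \<phi> x \<alpha> = \<phi> y \<alpha>" for x y
    proof -
      have "\<phi> x \<in> (\<Pi>\<^sub>E \<alpha>\<in>\<Lambda>. carrier (F \<alpha>))" "\<phi> y \<in> (\<Pi>\<^sub>E \<alpha>\<in>\<Lambda>. carrier (F \<alpha>))"
        using hom that(1,2) by (auto simp: hemiring_hom_def prod_hemiring_def)
      then have "\<phi> x = \<phi> y" using that(3) by (rule PiE_ext)
      then show ?thesis using inj that(1,2) by (simp add: inj_on_def)
    qed
  qed (use F surj in simp_all)
qed

lemma subdirect_productI: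
  assumes "\<And>\<alpha>. \<alpha> \<in> \<Lambda> \<Longrightarrow> hemiring (F \<alpha>)"
    and hom: "\<And>\<alpha>. \<alpha> \<in> \<Lambda> \<Longrightarrow> f \<alpha> \<in> hemiring_hom S (F \<alpha>)"
    and surj: "\<And>\<alpha>. \<alpha> \<in> \<Lambda> \<Longrightarrow> f \<alpha> ` carrier S = carrier (F \<alpha>)"
    and inj: "\<And>x y. \<lbrakk>x \<in> carrier S; y \<in> carrier S; \<And>\<alpha>. \<alpha> \<in> \<Lambda> \<Longrightarrow> f \<alpha> x = f \<alpha> y\<rbrakk> \<Longrightarrow> x = y"
  shows "subdirect_product S \<Lambda> F"
proof -
  let ?\<phi> = "\<lambda>x. \<lambda>\<alpha>\<in>\<Lambda>. f \<alpha> x"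
  have "?\<phi> \<in> hemiring_hom S (prod_hemiring \<Lambda> F)"
    using hom unfolding hemiring_hom_def prod_hemiring_def
    by (fastforce simp: fun_eq_iff restrict_def)
  moreover have "inj_on ?\<phi> (carrier S)"
    using inj by (intro inj_onI) (metis restrict_apply')
  moreover have "(\<lambda>x. ?\<phi> x \<alpha>) ` carrier S = carrier (F \<alpha>)" if "\<alpha> \<in> \<Lambda>" for \<alpha>
    using surj[OF that] that by simp
  ultimately show ?thesis
    using assms(1) unfolding subdirect_product_def by blast
qed

lemma subdirect_product_of_quotients:
  assumes S: "hemiring S" and q: "\<And>\<alpha>. \<alpha> \<in> \<Lambda> \<Longrightarrow> hemiring_congruence (q \<alpha>) S"
    and sep: "\<And>x y. \<lbrakk>x \<in> carrier S; y \<in> carrier S; \<And>\<alpha>. \<alpha> \<in> \<Lambda> \<Longrightarrow> (x, y) \<in> q \<alpha>\<rbrakk> \<Longrightarrow> x = y"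
  shows "subdirect_product S \<Lambda> (\<lambda>\<alpha>. quotient_hemiring S (q \<alpha>))"
proof (rule subdirect_productI[where f = "\<lambda>\<alpha>. class_rep (q \<alpha>)"])
  fix x y
  assume xy: "x \<in> carrier S" "y \<in> carrier S"
    and eq: "\<And>\<alpha>. \<alpha> \<in> \<Lambda> \<Longrightarrow> class_rep (q \<alpha>) x = class_rep (q \<alpha>) y"
  show "x = y"
  proof (rule sep[OF xy])
    fix \<alpha> assume \<alpha>: "\<alpha> \<in> \<Lambda>"
    then have "equiv (carrier S) (q \<alpha>)"
      using q by (simp add: hemiring_congruence_def)
    then show "(x, y) \<in> q \<alpha>"
      using class_rep_eq_iff xy eq[OF \<alpha>] by metis
  qed
qed (use hemiring_quotient_hemiring[OF S] class_rep_hom[OF S] class_rep_surj[OF S] q in auto)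

text \<open>
  Minimal and simple semimodules enter in the same way, as a class \<open>C\<close> of semimodules that separates
  the elements of \<open>S\<close>.
\<close>

lemma subdirect_product_of_separating_class:
  fixes S :: "('a, 'x) ring_scheme" and C :: "('a, 'm, 'z) semimodule_scheme \<Rightarrow> bool"
  assumes S: "hemiring S" and C: "\<And>M. C M \<Longrightarrow> right_semimodule S M"
    and sep: "\<And>x y. \<lbrakk>x \<in> carrier S; y \<in> carrier S; x \<noteq> y\<rbrakk> \<Longrightarrow> \<exists>M. C M \<and> (x, y) \<notin> ann S M"
  obtains \<Lambda> :: "('a \<times> 'a) set" and M where
    "\<And>\<alpha>. \<alpha> \<in> \<Lambda> \<Longrightarrow> C (M \<alpha>)"
    "subdirect_product S \<Lambda> (\<lambda>\<alpha>. quotient_hemiring S (ann S (M \<alpha>)))"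
proof -
  define \<Lambda> where "\<Lambda> = carrier S \<times> carrier S - Id"
  have "\<forall>\<alpha>\<in>\<Lambda>. \<exists>M. C M \<and> \<alpha> \<notin> ann S M"
    using sep by (auto simp: \<Lambda>_def)
  then obtain M where M: "\<And>\<alpha>. \<alpha> \<in> \<Lambda> \<Longrightarrow> C (M \<alpha>)" "\<And>\<alpha>. \<alpha> \<in> \<Lambda> \<Longrightarrow> \<alpha> \<notin> ann S (M \<alpha>)"
    by metis
  have "subdirect_product S \<Lambda> (\<lambda>\<alpha>. quotient_hemiring S (ann S (M \<alpha>)))"
  proof (rule subdirect_product_of_quotients[OF S])
    show "hemiring_congruence (ann S (M \<alpha>)) S" if "\<alpha> \<in> \<Lambda>" for \<alpha>
      using hemiring_congruence_ann C M(1) that by blast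
    show "x = y"
      if "x \<in> carrier S" "y \<in> carrier S" "\<And>\<alpha>. \<alpha> \<in> \<Lambda> \<Longrightarrow> (x, y) \<in> ann S (M \<alpha>)" for x y
      \<comment> \<open>The factor indexed by a pair already separates that pair.\<close>
      using that M(2)[of "(x, y)"] by (auto simp: \<Lambda>_def)
  qed
  with M(1) show thesis by (rule that)
qed


section \<open>Semisimplicity\<close>

lemma Id_on_subset_rad: "Id_on (carrier S) \<subseteq> rad_m S" "Id_on (carrier S) \<subseteq> rad_s S"
  by (auto simp: rad_m_def rad_s_def ann_def)

lemma m_semisimple_if_subdirect_product:
  assumes S: "hemiring S" and prim: "\<forall>\<alpha>\<in>\<Lambda>. m_primitive (F \<alpha>)"
    and sub: "subdirect_product S \<Lambda> F"
  shows "m_semisimple S"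
proof -
  have "s = t" if st: "(s, t) \<in> rad_m S" for s t
    using sub
  proof (rule subdirect_productE)
    fix f
    assume f: "\<And>\<alpha>. \<alpha> \<in> \<Lambda> \<Longrightarrow> hemiring (F \<alpha>)" "\<And>\<alpha>. \<alpha> \<in> \<Lambda> \<Longrightarrow> f \<alpha> \<in> hemiring_hom S (F \<alpha>)"
      "\<And>\<alpha>. \<alpha> \<in> \<Lambda> \<Longrightarrow> f \<alpha> ` carrier S = carrier (F \<alpha>)"
      and inj: "\<And>x y. \<lbrakk>x \<in> carrier S; y \<in> carrier S; \<And>\<alpha>. \<alpha> \<in> \<Lambda> \<Longrightarrow> f \<alpha> x = f \<alpha> y\<rbrakk> \<Longrightarrow> x = y"
    show "s = t"
    proof (rule inj)
      show "s \<in> carrier S" "t \<in> carrier S"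
        using st by (auto simp: rad_m_def)
      show "f \<alpha> s = f \<alpha> t" if "\<alpha> \<in> \<Lambda>" for \<alpha>
        using S f(1-3)[OF that] bspec[OF prim that] st by (rule rad_m_subset_kernel)
    qed
  qed
  moreover have "rad_m S \<subseteq> carrier S \<times> carrier S"
    by (auto simp: rad_m_def)
  ultimately have "rad_m S \<subseteq> Id_on (carrier S)"
    by auto
  then show ?thesis
    unfolding m_semisimple_def using Id_on_subset_rad(1) by (rule subset_antisym)
qed

lemma s_semisimple_if_subdirect_product:
  assumes S: "hemiring S" and prim: "\<forall>\<alpha>\<in>\<Lambda>. s_primitive (F \<alpha>)"
    and sub: "subdirect_product S \<Lambda> F"
  shows "s_semisimple S"
proof -
  have "s = t" if st: "(s, t) \<in> rad_s S" for s t
    using sub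
  proof (rule subdirect_productE)
    fix f
    assume f: "\<And>\<alpha>. \<alpha> \<in> \<Lambda> \<Longrightarrow> hemiring (F \<alpha>)" "\<And>\<alpha>. \<alpha> \<in> \<Lambda> \<Longrightarrow> f \<alpha> \<in> hemiring_hom S (F \<alpha>)"
      "\<And>\<alpha>. \<alpha> \<in> \<Lambda> \<Longrightarrow> f \<alpha> ` carrier S = carrier (F \<alpha>)"
      and inj: "\<And>x y. \<lbrakk>x \<in> carrier S; y \<in> carrier S; \<And>\<alpha>. \<alpha> \<in> \<Lambda> \<Longrightarrow> f \<alpha> x = f \<alpha> y\<rbrakk> \<Longrightarrow> x = y"
    show "s = t"
    proof (rule inj)
      show "s \<in> carrier S" "t \<in> carrier S"
        using st by (auto simp: rad_s_def)
      show "f \<alpha> s = f \<alpha> t" if "\<alpha> \<in> \<Lambda>" for \<alpha>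
        using S f(1-3)[OF that] bspec[OF prim that] st by (rule rad_s_subset_kernel)
    qed
  qed
  moreover have "rad_s S \<subseteq> carrier S \<times> carrier S"
    by (auto simp: rad_s_def)
  ultimately have "rad_s S \<subseteq> Id_on (carrier S)"
    by auto
  then show ?thesis
    unfolding s_semisimple_def using Id_on_subset_rad(2) by (rule subset_antisym)
qed

lemma subdirect_product_if_m_semisimple:
  fixes S :: "('a, 'x) ring_scheme"
  assumes S: "hemiring S" and "m_semisimple S"
  shows "\<exists>(\<Lambda> :: ('a \<times> 'a) set) (F :: 'a \<times> 'a \<Rightarrow> 'a ring).
    (\<forall>\<alpha>\<in>\<Lambda>. m_primitive (F \<alpha>)) \<and> subdirect_product S \<Lambda> F"
proof -
  have "\<exists>M :: ('a, 'a) semimodule. minimal_semimodule S M \<and> (x, y) \<notin> ann S M"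
    if "x \<in> carrier S" "y \<in> carrier S" "x \<noteq> y" for x y
  proof -
    have "(x, y) \<notin> rad_m S" using assms(2) that(3) by (auto simp: m_semisimple_def)
    then show ?thesis using that(1,2) by (auto simp: rad_m_def)
  qed
  moreover have "right_semimodule S M" if "minimal_semimodule S M" for M :: "('a, 'a) semimodule"
    using that by (simp add: minimal_semimodule_def)
  ultimately obtain \<Lambda> :: "('a \<times> 'a) set" and M :: "'a \<times> 'a \<Rightarrow> ('a, 'a) semimodule" where
    M: "\<And>\<alpha>. \<alpha> \<in> \<Lambda> \<Longrightarrow> minimal_semimodule S (M \<alpha>)"
    and sub: "subdirect_product S \<Lambda> (\<lambda>\<alpha>. quotient_hemiring S (ann S (M \<alpha>)))"
    using subdirect_product_of_separating_class[OF S, of "minimal_semimodule S"] by metis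
  have "\<forall>\<alpha>\<in>\<Lambda>. m_primitive (quotient_hemiring S (ann S (M \<alpha>)))"
    by (intro ballI m_primitive_quotient_ann M)
  with sub show ?thesis by (intro exI conjI)
qed

lemma subdirect_product_if_s_semisimple:
  fixes S :: "('a, 'x) ring_scheme"
  assumes S: "hemiring S" and "s_semisimple S"
  shows "\<exists>(\<Lambda> :: ('a \<times> 'a) set) (F :: 'a \<times> 'a \<Rightarrow> 'a ring).
    (\<forall>\<alpha>\<in>\<Lambda>. s_primitive (F \<alpha>)) \<and> subdirect_product S \<Lambda> F"
proof -
  have "\<exists>M :: ('a, 'a) semimodule. simple_semimodule S M \<and> (x, y) \<notin> ann S M"
    if "x \<in> carrier S" "y \<in> carrier S" "x \<noteq> y" for x y
  proof -
    have "(x, y) \<notin> rad_s S" using assms(2) that(3) by (auto simp: s_semisimple_def)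
    then show ?thesis using that(1,2) by (auto simp: rad_s_def)
  qed
  moreover have "right_semimodule S M" if "simple_semimodule S M" for M :: "('a, 'a) semimodule"
    using that by (simp add: simple_semimodule_def minimal_semimodule_def)
  ultimately obtain \<Lambda> :: "('a \<times> 'a) set" and M :: "'a \<times> 'a \<Rightarrow> ('a, 'a) semimodule" where
    M: "\<And>\<alpha>. \<alpha> \<in> \<Lambda> \<Longrightarrow> simple_semimodule S (M \<alpha>)"
    and sub: "subdirect_product S \<Lambda> (\<lambda>\<alpha>. quotient_hemiring S (ann S (M \<alpha>)))"
    using subdirect_product_of_separating_class[OF S, of "simple_semimodule S"] by metis
  have "\<forall>\<alpha>\<in>\<Lambda>. s_primitive (quotient_hemiring S (ann S (M \<alpha>)))"
    by (intro ballI s_primitive_quotient_ann M)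
  with sub show ?thesis by (intro exI conjI)
qed

theorem theorem4p7:
  fixes S :: "'a ring"
  assumes "hemiring S"
  shows
    "(m_semisimple S \<longleftrightarrow>
        (\<exists>(\<Lambda> :: ('a \<times> 'a) set) (F :: 'a \<times> 'a \<Rightarrow> 'a ring).
           (\<forall>\<alpha>\<in>\<Lambda>. m_primitive (F \<alpha>)) \<and> subdirect_product S \<Lambda> F))
     \<and> (\<forall>(\<Lambda> :: 'i set) (F :: 'i \<Rightarrow> 'b ring).
          (\<forall>\<alpha>\<in>\<Lambda>. m_primitive (F \<alpha>)) \<and> subdirect_product S \<Lambda> F \<longrightarrow> m_semisimple S)
     \<and> (s_semisimple S \<longleftrightarrow>
        (\<exists>(\<Lambda> :: ('a \<times> 'a) set) (F :: 'a \<times> 'a \<Rightarrow> 'a ring).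
           (\<forall>\<alpha>\<in>\<Lambda>. s_primitive (F \<alpha>)) \<and> subdirect_product S \<Lambda> F))
     \<and> (\<forall>(\<Lambda> :: 'i set) (F :: 'i \<Rightarrow> 'b ring).
          (\<forall>\<alpha>\<in>\<Lambda>. s_primitive (F \<alpha>)) \<and> subdirect_product S \<Lambda> F \<longrightarrow> s_semisimple S)"
proof (intro conjI allI impI iffI)
  assume "\<exists>(\<Lambda> :: ('a \<times> 'a) set) (F :: 'a \<times> 'a \<Rightarrow> 'a ring).
    (\<forall>\<alpha>\<in>\<Lambda>. m_primitive (F \<alpha>)) \<and> subdirect_product S \<Lambda> F"
  then show "m_semisimple S"
    by (elim exE conjE) (rule m_semisimple_if_subdirect_product[OF assms])
next
  fix \<Lambda> :: "'i set" and F :: "'i \<Rightarrow> 'b ring"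
  assume "(\<forall>\<alpha>\<in>\<Lambda>. m_primitive (F \<alpha>)) \<and> subdirect_product S \<Lambda> F"
  then show "m_semisimple S"
    by (elim conjE) (rule m_semisimple_if_subdirect_product[OF assms])
next
  assume "\<exists>(\<Lambda> :: ('a \<times> 'a) set) (F :: 'a \<times> 'a \<Rightarrow> 'a ring).
    (\<forall>\<alpha>\<in>\<Lambda>. s_primitive (F \<alpha>)) \<and> subdirect_product S \<Lambda> F"
  then show "s_semisimple S"
    by (elim exE conjE) (rule s_semisimple_if_subdirect_product[OF assms])
next
  fix \<Lambda> :: "'i set" and F :: "'i \<Rightarrow> 'b ring"
  assume "(\<forall>\<alpha>\<in>\<Lambda>. s_primitive (F \<alpha>)) \<and> subdirect_product S \<Lambda> F"
  then show "s_semisimple S"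
    by (elim conjE) (rule s_semisimple_if_subdirect_product[OF assms])
qed (erule subdirect_product_if_m_semisimple[OF assms],
    erule subdirect_product_if_s_semisimple[OF assms])

end
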